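(* Let $k\ge 1$ and let $B_{k+1}$ be a generalized Bethe tree with $k+1$ levels, with $n$ vertices, in which the root (level $1$) has degree $d_1$ and every vertex on level $i$ has degree $d_i+1$ for $1<i\le k$ (so every vertex on level $i$, $1\le i\le k$, has exactly $d_i$ children, and the vertices on level $k+1$ are pendent). Then $$W(B_{k+1})=\sum_{i=1}^{k} n_{i+1}\, m_i\,(n-m_i),$$ where $n_{i+1}=d_1d_2\cdots d_i$ and $m_i=1+\sum_{j=i+1}^{k}\prod_{r=i+1}^{j} d_r$ for $1\le i\le k$ (so $m_k=1$).
   Context: For a connected graph $G$, $d(u,v)$ denotes the distance (number of edges of a shortest path) between $u$ and $v$, and the Wiener index is $W(G)=\sum_{\{u,v\}\subseteq V(G)} d(u,v)$, the sum over unordered pairs of distinct vertices. A generalized Bethe tree is a rooted tree in which all vertices at the same level have equal degrees; the root is at level $1$, its children at level $2$, and so on; a tree with $k+1$ levels has its deepest vertices at level $k+1$. *)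

theory Defs
  imports "Graph_Theory.Graph_Theory"
begin

text \<open>
  Finite simple graphs are the \<open>graph\<close> locale of the library: symmetric digraphs without
  loops and multiple arcs, each edge being a pair of opposite arcs. Hence \<open>out_degree\<close> is the
  degree, and the number of arcs of an \<open>apath\<close> is its number of edges.
\<close>

definition graph_dist :: "('a, 'b) pre_digraph \<Rightarrow> 'a \<Rightarrow> 'a \<Rightarrow> nat" where
  "graph_dist G u v = (LEAST l. \<exists>p. pre_digraph.apath G u p v \<and> length p = l)"

text \<open>
  The sum ranges over the two-element sets of vertices; \<open>THE\<close> picks the common value of
  \<open>graph_dist G u v\<close> and \<open>graph_dist G v u\<close>.
\<close>

definition wiener_index :: "('a, 'b) pre_digraph \<Rightarrow> nat" where
  "wiener_index G =
    (\<Sum>e \<in> {{u, v} | u v. u \<in> verts G \<and> v \<in> verts G \<and> u \<noteq> v}.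
       THE l. \<exists>u v. e = {u, v} \<and> l = graph_dist G u v)"

text \<open>
  The library's \<open>tree\<close> is unsuitable for symmetric digraphs: there the two arcs of an edge
  form a cycle of length 2. The cycles of the undirected graph are those of length at least 3.
\<close>

definition undirected_tree :: "('a, 'b) pre_digraph \<Rightarrow> bool" where
  "undirected_tree G \<longleftrightarrow>
     graph G \<and> connected G \<and> \<not> (\<exists>p. pre_digraph.cycle G p \<and> 3 \<le> length p)"

definition level :: "('a, 'b) pre_digraph \<Rightarrow> 'a \<Rightarrow> 'a \<Rightarrow> nat" where
  "level G \<rho> v = graph_dist G \<rho> v + 1"

definition num_levels :: "('a, 'b) pre_digraph \<Rightarrow> 'a \<Rightarrow> nat" where
  "num_levels G \<rho> = Max (level G \<rho> ` verts G)"

definition generalized_Bethe_tree :: "('a, 'b) pre_digraph \<Rightarrow> 'a \<Rightarrow> bool" where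
  "generalized_Bethe_tree G \<rho> \<longleftrightarrow>
     undirected_tree G \<and> \<rho> \<in> verts G \<and>
     (\<forall>u \<in> verts G. \<forall>v \<in> verts G.
        level G \<rho> u = level G \<rho> v \<longrightarrow> out_degree G u = out_degree G v)"

lemma (in graph) apath_reverse:
  assumes "apath u p v"
  shows "\<exists>q. apath v q u \<and> length q = length p"
proof -
  have "\<exists>q. awalk v q u \<and> length q = length p \<and> awalk_verts v q = rev (awalk_verts u p)"
    if "awalk u p v" for u p
    using that
  proof (induction p arbitrary: u)
    case Nil
    then show ?case by (auto simp: awalk_Nil_iff)
  next
    case (Cons a p)
    then have a: "a \<in> arcs G" "u = tail G a" and p: "awalk (head G a) p v"
      by (auto simp: awalk_Cons_iff)
    obtain q where q: "awalk v q (head G a)" "length q = length p"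
        "awalk_verts v q = rev (awalk_verts (head G a) p)"
      using Cons.IH[OF p] by blast
    have "(head G a, tail G a) \<in> arcs_ends G"
      using a sym_arcs by (auto simp: symmetric_def arcs_ends_conv dest: symD)
    then obtain b where b: "b \<in> arcs G" "tail G b = head G a" "head G b = tail G a"
      by (auto simp: arcs_ends_conv)
    then have *: "awalk (head G a) [b] u"
      using a by (auto simp: awalk_Cons_iff awalk_Nil_iff)
    have "awalk v (q @ [b]) u" using q(1) * by (rule awalk_appendI)
    moreover from this have "awalk_verts v (q @ [b]) = awalk_verts v q @ [u]"
      using a b by (subst awalk_verts_append) auto
    ultimately show ?case using q a by (intro exI[of _ "q @ [b]"]) simp
  qed
  from this[of u p] assms show ?thesis by (auto simp: apath_def)
qed

lemma (in graph) graph_dist_commute: "graph_dist G u v = graph_dist G v u"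
  unfolding graph_dist_def using apath_reverse by (intro arg_cong[where f = Least] ext) metis

lemma (in graph) the_graph_dist:
  "(THE l. \<exists>x y. {u, v} = {x, y} \<and> l = graph_dist G x y) = graph_dist G u v"
  by (rule the_equality) (auto simp: doubleton_eq_iff graph_dist_commute)

end

theory Submission
  imports Defs
begin

text \<open>
  Removing the edge between a non-root vertex \<open>c\<close> and its parent splits the tree into the
  descendants of \<open>c\<close> and the rest, and the distance of two vertices is the number of edges
  that separate them. Exchanging the two summations, \<open>W\<close> is the sum over \<open>c\<close> of
  \<open>s (n - s)\<close>, where \<open>s\<close> is the number of descendants of \<open>c\<close>, itself included. In a
  generalized Bethe tree there are \<open>n\<^sub>i\<^sub>+\<^sub>1\<close> such \<open>c\<close> on level \<open>i + 1\<close>, each with \<open>s = m\<^sub>i\<close>.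
\<close>

section \<open>Distances and degrees in a simple graph\<close>

context graph
begin

text \<open>\<open>graph_dist\<close> minimises over paths only, so a walk is first cut down to a
  path inside its arc set. A path repeats no arc, hence its length is the size of that set.\<close>

lemma graph_dist_le:
  assumes "awalk u p v"
  shows "graph_dist G u v \<le> length p"
proof -
  obtain q where q: "apath u q v" "set q \<subseteq> set p"
    using apath_awalk_to_apath[OF assms] awalk_to_apath_subset[OF assms] by blast
  have "distinct q"
    using q(1) by (auto simp: apath_def intro: distinct_verts_imp_distinct)
  then have "length q = card (set q)"
    by (simp add: distinct_card)
  also have "\<dots> \<le> card (set p)"
    using q(2) by (simp add: card_mono)
  also have "\<dots> \<le> length p"
    by (rule card_length)
  finally have "length q \<le> length p" .
  moreover have "graph_dist G u v \<le> length q"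
    unfolding graph_dist_def using q(1) by (auto intro: Least_le)
  ultimately show ?thesis by simp
qed

text \<open>Connectedness makes the set under \<open>LEAST\<close> nonempty, so the minimum is
  attained.\<close>

lemma shortest_apath:
  assumes "connected G" "u \<in> verts G" "v \<in> verts G"
  obtains p where "apath u p v" "length p = graph_dist G u v"
proof -
  have "strongly_connected G"
    using assms(1) sym_arcs by (rule symmetric_connected_imp_strongly_connected[rotated])
  then have "u \<rightarrow>\<^sup>* v" using assms(2,3) by auto
  then have "\<exists>l p. apath u p v \<and> length p = l"
    by (auto simp: reachable_apath)
  then have "\<exists>p. apath u p v \<and> length p = graph_dist G u v"
    unfolding graph_dist_def by (rule LeastI_ex)
  then show ?thesis using that by blast
qed

lemma out_degree_eq_card_neighbours: "out_degree G v = card {w. v \<rightarrow>\<^bsub>G\<^esub> w}"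
proof -
  have "{w. v \<rightarrow>\<^bsub>G\<^esub> w} = head G ` out_arcs G v"
    by (auto simp: arcs_ends_conv)
  moreover have "inj_on (head G) (out_arcs G v)"
    by (rule inj_onI) (auto intro: no_multi_arcs simp: arc_to_ends_def)
  ultimately show ?thesis
    by (simp add: out_degree_def card_image)
qed

end

section \<open>Depth and parents in a rooted tree\<close>

locale rooted_tree = graph G for G :: "('a, 'b) pre_digraph" (structure) +
  fixes \<rho> :: 'a
  assumes tree: "undirected_tree G" and root: "\<rho> \<in> verts G"
begin

abbreviation depth :: "'a \<Rightarrow> nat" where
  "depth \<equiv> graph_dist G \<rho>"

text \<open>Parenthood is read off from distances to the root. Acyclicity enters only afterwards, to
  show that this orients every edge (\<open>adj_cases\<close>) and that parents are unique
  (\<open>parent_unique\<close>).\<close>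

definition child_rel :: "('a \<times> 'a) set" where
  "child_rel = {(u, v). u \<rightarrow>\<^bsub>G\<^esub> v \<and> depth v = Suc (depth u)}"

definition descendants :: "'a \<Rightarrow> 'a set" where
  "descendants v = child_rel\<^sup>* `` {v}"

lemma conn: "connected G"
  using tree by (simp add: undirected_tree_def)

lemma depth_root: "depth \<rho> = 0"
  using graph_dist_le[of \<rho> "[]" \<rho>] root by (simp add: awalk_Nil_iff)

lemma depth_eq_0:
  assumes "v \<in> verts G" "depth v = 0"
  shows "v = \<rho>"
  using shortest_apath[OF conn root assms(1)] assms(2) by (auto simp: apath_Nil_iff)

lemma depth_adj_le:
  assumes "u \<rightarrow>\<^bsub>G\<^esub> v"
  shows "depth v \<le> Suc (depth u)"
proof -
  have "u \<in> verts G" using assms by (rule adj_in_verts)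
  then obtain p where p: "apath \<rho> p u" "length p = depth u"
    using shortest_apath[OF conn root] by blast
  from assms obtain a where "a \<in> arcs G" "tail G a = u" "head G a = v"
    by (auto simp: arcs_ends_conv)
  then have "awalk u [a] v" by (auto simp: awalk_simps)
  then have "awalk \<rho> (p @ [a]) v"
    using p(1) by (intro awalk_appendI) (auto simp: apath_def)
  from graph_dist_le[OF this] show ?thesis using p(2) by simp
qed

text \<open>The last vertex but one on a shortest path from the root is a parent.\<close>

lemma ex_parent:
  assumes "v \<in> verts G" "v \<noteq> \<rho>"
  shows "\<exists>u. (u, v) \<in> child_rel"
proof -
  obtain p where p: "apath \<rho> p v" "length p = depth v"
    using shortest_apath[OF conn root assms(1)] by blast
  with assms(2) have "p \<noteq> []" by (auto simp: apath_Nil_iff)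
  then obtain q a where pq: "p = q @ [a]" by (cases p rule: rev_cases) auto
  then have q: "awalk \<rho> q (tail G a)" and a: "a \<in> arcs G" "head G a = v"
    using p(1) by (auto simp: apath_def awalk_simps)
  have "tail G a \<rightarrow>\<^bsub>G\<^esub> v" using in_arcs_imp_in_arcs_ends[OF a(1)] a(2) by simp
  moreover from this have "depth v \<le> Suc (depth (tail G a))" by (rule depth_adj_le)
  moreover have "depth (tail G a) \<le> length q" using q by (rule graph_dist_le)
  ultimately show ?thesis using p(2) pq by (auto simp: child_rel_def)
qed

text \<open>
  Extending the path at both ends by an arc towards the root keeps the hypotheses, one level
  higher, until the two new ends coincide and close a cycle.
\<close>

lemma no_apath_above_level:
  assumes "apath x p y" "x \<noteq> y" "depth x = depth y"
    and "\<And>w. w \<in> set (awalk_verts x p) \<Longrightarrow> depth x \<le> depth w"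
  shows False
  using assms
proof (induction "depth x" arbitrary: x p y)
  case 0
  then have "x \<in> verts G" "y \<in> verts G" by (auto simp: apath_def)
  then show ?case using 0 depth_eq_0 by metis
next
  case (Suc i)
  then have p: "awalk x p y" "distinct (awalk_verts x p)" by (auto simp: apath_def)
  then have V: "x \<in> verts G" "y \<in> verts G" by auto
  have "x \<noteq> \<rho>" "y \<noteq> \<rho>" using Suc.hyps(2) Suc.prems(3) depth_root by auto
  with V obtain x' y' where par: "(x', x) \<in> child_rel" "(y', y) \<in> child_rel"
    using ex_parent by blast
  then have adj: "x' \<rightarrow>\<^bsub>G\<^esub> x" "y \<rightarrow>\<^bsub>G\<^esub> y'" and dep: "depth x' = i" "depth y' = i"
    using Suc.hyps(2) Suc.prems(3) graph_symmetric by (auto simp: child_rel_def)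
  from adj obtain a b where a: "a \<in> arcs G" "tail G a = x'" "head G a = x"
    and b: "b \<in> arcs G" "tail G b = y" "head G b = y'"
    by (auto simp: arcs_ends_conv)
  let ?q = "a # p @ [b]"
  have pb: "awalk x (p @ [b]) y'"
    using p(1) b by (intro awalk_appendI) (auto simp: awalk_simps)
  then have q: "awalk x' ?q y'" using a by (auto simp: awalk_Cons_iff)
  have "awalk_verts x (p @ [b]) = awalk_verts x p @ [y']"
    using awalk_verts_append[OF pb] p(1) b by simp
  then have verts_q: "awalk_verts x' ?q = x' # awalk_verts x p @ [y']"
    using a by simp
  \<comment> \<open>The new ends have depth \<open>i\<close>, whereas the old path stays at depth at
    least \<open>Suc i\<close>.\<close>
  have notin: "x' \<notin> set (awalk_verts x p)" "y' \<notin> set (awalk_verts x p)"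
    using Suc.prems(4) Suc.hyps(2) dep by fastforce+
  show ?case
  proof (cases "x' = y'")
    case True
    then have "cycle ?q"
      unfolding cycle_def using q verts_q notin p(2) by (intro exI[of _ x']) auto
    \<comment> \<open>With \<open>p\<close> empty, \<open>?q\<close> could be the two opposite arcs
      of one edge, a 2-cycle that \<open>undirected_tree\<close> permits.\<close>
    moreover have "p \<noteq> []" using p(1) \<open>x \<noteq> y\<close> by (auto simp: awalk_Nil_iff)
    then have "3 \<le> length ?q" by (cases p) auto
    ultimately show ?thesis using tree by (auto simp: undirected_tree_def)
  next
    case False
    have "apath x' ?q y'"
      using q verts_q notin p(2) False by (auto simp: apath_def)
    moreover have "depth x' \<le> depth w" if "w \<in> set (awalk_verts x' ?q)" for w
      using that Suc.prems(4)[of w] Suc.hyps(2) dep unfolding verts_q by auto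
    ultimately show ?thesis
      using Suc.hyps(1)[of x' ?q y'] False dep by simp
  qed
qed

text \<open>An edge inside one level would be a one-arc path of the kind excluded by
  \<open>no_apath_above_level\<close>.\<close>

lemma depth_adj_neq:
  assumes "u \<rightarrow>\<^bsub>G\<^esub> v"
  shows "depth u \<noteq> depth v"
proof
  assume eq: "depth u = depth v"
  from assms obtain a where a: "a \<in> arcs G" "tail G a = u" "head G a = v"
    by (auto simp: arcs_ends_conv)
  have "u \<noteq> v" using assms adj_not_same by blast
  then have "apath u [a] v" using a by (auto simp: apath_def awalk_simps)
  then show False
    using \<open>u \<noteq> v\<close> eq a by (elim no_apath_above_level) auto
qed

lemma adj_cases:
  assumes "u \<rightarrow>\<^bsub>G\<^esub> v"
  shows "(u, v) \<in> child_rel \<or> (v, u) \<in> child_rel"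
  using depth_adj_le[OF assms] depth_adj_le[of v u] depth_adj_neq[OF assms] assms
    graph_symmetric[OF assms]
  by (auto simp: child_rel_def)

text \<open>Two distinct parents would be the ends of a path through \<open>v\<close>, which lies
  deeper than both; \<open>no_apath_above_level\<close> excludes it.\<close>

lemma parent_unique:
  assumes "(u, v) \<in> child_rel" "(w, v) \<in> child_rel"
  shows "u = w"
proof (rule ccontr)
  assume "u \<noteq> w"
  have adj: "u \<rightarrow>\<^bsub>G\<^esub> v" "v \<rightarrow>\<^bsub>G\<^esub> w" and dep: "depth v = Suc (depth u)" "depth v = Suc (depth w)"
    using assms graph_symmetric by (auto simp: child_rel_def)
  from adj obtain a b where a: "a \<in> arcs G" "tail G a = u" "head G a = v"
    and b: "b \<in> arcs G" "tail G b = v" "head G b = w"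
    by (auto simp: arcs_ends_conv)
  have "u \<noteq> v" "v \<noteq> w" using dep by auto
  then have "apath u [a, b] w"
    using a b \<open>u \<noteq> w\<close> by (auto simp: apath_def awalk_simps)
  then show False
    using \<open>u \<noteq> w\<close> dep a b by (elim no_apath_above_level) auto
qed

lemma child_relD:
  assumes "(u, v) \<in> child_rel"
  shows "u \<in> verts G" "v \<in> verts G" "depth v = Suc (depth u)" "v \<noteq> \<rho>"
  using assms adj_in_verts depth_root by (auto simp: child_rel_def)

section \<open>Descendants and subtree sizes\<close>

lemma descendants_subset: "v \<in> verts G \<Longrightarrow> descendants v \<subseteq> verts G"
  unfolding descendants_def by (auto elim: rtranclE dest: child_relD)

lemma finite_descendants: "v \<in> verts G \<Longrightarrow> finite (descendants v)"
  using descendants_subset finite_verts by (rule finite_subset)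

lemma depth_descendant:
  assumes "x \<in> descendants v" "x \<noteq> v"
  shows "depth v < depth x"
proof -
  have "(v, x) \<in> child_rel\<^sup>+"
    using assms by (auto simp: descendants_def rtrancl_eq_or_trancl)
  then show ?thesis by induction (auto dest: child_relD(3))
qed

lemma depth_descendant_le: "x \<in> descendants v \<Longrightarrow> depth v \<le> depth x"
  by (cases "x = v") (auto dest: depth_descendant)

lemma parent_notin_descendants: "(p, c) \<in> child_rel \<Longrightarrow> p \<notin> descendants c"
  using child_relD(3)[of p c] depth_descendant_le[of p c] by auto

text \<open>Since the parent is unique, every nontrivial descending chain ending in \<open>c\<close>
  passes through \<open>p\<close> last.\<close>

lemma child_in_descendants_iff:
  assumes "(p, c) \<in> child_rel"
  shows "c \<in> descendants v \<longleftrightarrow> c = v \<or> p \<in> descendants v"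
proof
  assume "c \<in> descendants v"
  then have "(v, c) \<in> child_rel\<^sup>*" by (simp add: descendants_def)
  then show "c = v \<or> p \<in> descendants v"
    by (cases rule: rtranclE) (auto simp: descendants_def dest: parent_unique[OF assms])
next
  assume "c = v \<or> p \<in> descendants v"
  then show "c \<in> descendants v"
    using assms by (auto simp: descendants_def intro: rtrancl_into_rtrancl)
qed

text \<open>Climb from \<open>x\<close> to \<open>a\<close>: a vertex strictly below
  \<open>a\<close> is deeper than \<open>b\<close>, hence differs from \<open>b\<close>, so its
  parent still descends from \<open>b\<close>. Once \<open>a\<close> is reached, equal depths force
  \<open>a = b\<close>.\<close>

lemma ancestor_unique:
  assumes "x \<in> descendants a" "x \<in> descendants b" "depth a = depth b"
  shows "a = b"
proof -
  have "(a, x) \<in> child_rel\<^sup>*" using assms(1) by (simp add: descendants_def)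
  then show ?thesis using assms(2)
  proof induction
    case base
    then show ?case using depth_descendant[of a b] assms(3) by auto
  next
    case (step x c)
    have "x \<in> descendants a" using step by (simp add: descendants_def)
    then have "depth a \<le> depth x" by (rule depth_descendant_le)
    then have "c \<noteq> b" using child_relD(3)[OF step(2)] assms(3) by auto
    then show ?case using step child_in_descendants_iff[OF step(2)] by blast
  qed
qed

lemma descendants_unfold:
  "descendants v = insert v (\<Union>c \<in> child_rel `` {v}. descendants c)"
  unfolding descendants_def by (auto elim: converse_rtranclE intro: converse_rtrancl_into_rtrancl)

lemma finite_children: "finite (child_rel `` {v})"
  by (rule finite_subset[OF _ finite_verts]) (auto dest: child_relD)

text \<open>The children of \<open>v\<close> have equal depth, so by \<open>ancestor_unique\<close>
  their subtrees are disjoint.\<close>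

lemma card_descendants:
  assumes "v \<in> verts G"
  shows "card (descendants v) = 1 + (\<Sum>c \<in> child_rel `` {v}. card (descendants c))"
proof -
  have "v \<notin> (\<Union>c \<in> child_rel `` {v}. descendants c)"
    using parent_notin_descendants by auto
  moreover have "finite (\<Union>c \<in> child_rel `` {v}. descendants c)"
    using finite_children by (auto intro: finite_descendants dest: child_relD)
  moreover have "card (\<Union>c \<in> child_rel `` {v}. descendants c) =
      (\<Sum>c \<in> child_rel `` {v}. card (descendants c))"
  proof (rule card_UN_disjoint[OF finite_children])
    show "\<forall>c \<in> child_rel `` {v}. finite (descendants c)"
      by (auto intro: finite_descendants dest: child_relD)
    show "\<forall>c \<in> child_rel `` {v}. \<forall>c' \<in> child_rel `` {v}.
        c \<noteq> c' \<longrightarrow> descendants c \<inter> descendants c' = {}"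
    proof (intro ballI impI equals0I)
      fix c c' x
      assume "c \<in> child_rel `` {v}" "c' \<in> child_rel `` {v}" "c \<noteq> c'"
        "x \<in> descendants c \<inter> descendants c'"
      then show False
        using ancestor_unique[of x c c'] child_relD(3)[of v] by auto
    qed
  qed
  ultimately show ?thesis
    by (subst descendants_unfold) simp
qed

section \<open>Distance as the number of separating edges\<close>

text \<open>
  A non-root vertex stands for the edge to its parent. The vertices below are the edges whose
  removal separates \<open>x\<close> from \<open>y\<close>, that is, the edges of the path between them.
\<close>

definition separators :: "'a \<Rightarrow> 'a \<Rightarrow> 'a set" where
  "separators x y = {c \<in> verts G - {\<rho>}. (x \<in> descendants c) \<noteq> (y \<in> descendants c)}"

lemma finite_separators: "finite (separators x y)"
  by (simp add: separators_def)

lemma separators_commute: "separators x y = separators y x"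
  by (auto simp: separators_def)

text \<open>A parent and its child descend from the same vertices, except that only the child
  descends from itself.\<close>

lemma separators_child:
  assumes "(p, c) \<in> child_rel"
  shows "separators p c = {c}"
  using parent_notin_descendants[OF assms] child_in_descendants_iff[OF assms] child_relD[OF assms]
  by (auto simp: separators_def)

lemma card_separators_adj: "u \<rightarrow>\<^bsub>G\<^esub> v \<Longrightarrow> card (separators u v) = 1"
  using adj_cases[of u v] separators_child[of u v] separators_child[of v u]
    separators_commute[of u v] by auto

text \<open>Separators obey a triangle inequality, and each arc of the walk contributes exactly
  one.\<close>

lemma card_separators_le: "awalk x p y \<Longrightarrow> card (separators x y) \<le> length p"
proof (induction p arbitrary: x)
  case Nil
  then show ?case by (simp add: awalk_Nil_iff separators_def)
next
  case (Cons a p)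
  then have a: "x \<rightarrow>\<^bsub>G\<^esub> head G a" and p: "awalk (head G a) p y"
    by (auto simp: awalk_Cons_iff in_arcs_imp_in_arcs_ends)
  have "separators x y \<subseteq> separators x (head G a) \<union> separators (head G a) y"
    by (auto simp: separators_def)
  then have "card (separators x y) \<le> card (separators x (head G a) \<union> separators (head G a) y)"
    by (intro card_mono) (simp_all add: finite_separators)
  also have "\<dots> \<le> card (separators x (head G a)) + card (separators (head G a) y)"
    by (rule card_Un_le)
  also have "\<dots> \<le> 1 + length p"
    using card_separators_adj[OF a] Cons.IH[OF p] by simp
  finally show ?case by simp
qed

text \<open>As \<open>y\<close> is no deeper than \<open>x\<close>, it is not below
  \<open>x\<close>. Moving from \<open>x\<close> to its parent therefore crosses one separating edge
  and changes no other.\<close>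

lemma card_separators_parent:
  assumes "(p, x) \<in> child_rel" "depth y \<le> depth x" "x \<noteq> y"
  shows "card (separators x y) = Suc (card (separators p y))"
proof -
  have "y \<notin> descendants x" using depth_descendant[of y x] assms by auto
  moreover have "p \<notin> descendants x"
    using assms(1) by (rule parent_notin_descendants)
  ultimately have "separators x y = insert x (separators p y)" "x \<notin> separators p y"
    using child_in_descendants_iff[OF assms(1)] child_relD[OF assms(1)]
    by (auto simp: separators_def)
  then show ?thesis by (simp add: finite_separators)
qed

text \<open>Induction on the sum of the depths: replacing the deeper end by its parent costs one arc
  and removes one separator.\<close>

lemma graph_dist_le_card_separators:
  assumes "x \<in> verts G" "y \<in> verts G"
  shows "graph_dist G x y \<le> card (separators x y)"
  using assms
proof (induction "depth x + depth y" arbitrary: x y rule: less_induct)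
  case less
  \<comment> \<open>Stated for fresh \<open>x\<close> and \<open>y\<close> with \<open>x\<close> the
    deeper one, so that it also applies with the two ends exchanged.\<close>
  have step: "graph_dist G x y \<le> card (separators x y)"
    if xy: "x \<in> verts G" "y \<in> verts G" "depth y \<le> depth x" "x \<noteq> y"
      and IH: "\<And>p. \<lbrakk>p \<in> verts G; depth p < depth x\<rbrakk> \<Longrightarrow> graph_dist G p y \<le> card (separators p y)"
    for x y
  proof -
    have "x \<noteq> \<rho>" using xy depth_root depth_eq_0 by (metis le_zero_eq)
    then obtain p where p: "(p, x) \<in> child_rel" using ex_parent xy(1) by blast
    then have "x \<rightarrow>\<^bsub>G\<^esub> p" using graph_symmetric by (auto simp: child_rel_def)
    then obtain a where a: "a \<in> arcs G" "tail G a = x" "head G a = p"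
      by (auto simp: arcs_ends_conv)
    obtain q where q: "apath p q y" "length q = graph_dist G p y"
      using shortest_apath[OF conn child_relD(1)[OF p] xy(2)] by blast
    then have "awalk x (a # q) y" using a by (auto simp: apath_def awalk_Cons_iff)
    then have "graph_dist G x y \<le> Suc (graph_dist G p y)"
      using graph_dist_le[of x "a # q" y] q(2) by simp
    also have "\<dots> \<le> Suc (card (separators p y))"
      using IH[of p] child_relD[OF p] by simp
    also have "\<dots> = card (separators x y)"
      using card_separators_parent[OF p xy(3,4)] by simp
    finally show ?thesis .
  qed
  consider "x = y" | "x \<noteq> y" "depth y \<le> depth x" | "x \<noteq> y" "depth x \<le> depth y" by linarith
  then show ?case
  proof cases
    case 1
    then show ?thesis
      using graph_dist_le[of x "[]" y] less.prems by (simp add: awalk_Nil_iff)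
  next
    case 2
    show ?thesis by (rule step[OF less.prems 2(2,1)]) (use less in auto)
  next
    case 3
    then have "graph_dist G y x \<le> card (separators y x)"
      by (intro step[OF less.prems(2,1)]) (use less in auto)
    then show ?thesis by (simp add: graph_dist_commute separators_commute)
  qed
qed

lemma graph_dist_eq_card_separators:
  assumes "x \<in> verts G" "y \<in> verts G"
  shows "graph_dist G x y = card (separators x y)"
proof (rule antisym)
  obtain p where "apath x p y" "length p = graph_dist G x y"
    using shortest_apath[OF conn assms] by blast
  then show "card (separators x y) \<le> graph_dist G x y"
    using card_separators_le[of x p y] by (simp add: apath_def)
qed (rule graph_dist_le_card_separators[OF assms])

section \<open>The Wiener index as a sum over edges\<close>

lemma wiener_index_eq_sum_descendants:
  "wiener_index G =
    (\<Sum>c \<in> verts G - {\<rho>}. card (descendants c) * (card (verts G) - card (descendants c)))"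
proof -
  let ?E = "{{u, v} | u v. u \<in> verts G \<and> v \<in> verts G \<and> u \<noteq> v}"
  \<comment> \<open>Being separated by \<open>c\<close> has to be a property of the unordered pair
    \<open>e\<close>; the existential chooses the order that puts the end below \<open>c\<close>
    first.\<close>
  let ?sep = "\<lambda>e c. \<exists>x y. e = {x, y} \<and> x \<in> descendants c \<and> y \<notin> descendants c"
  have finE: "finite ?E"
    by (rule finite_subset[of _ "Pow (verts G)"]) auto
  \<comment> \<open>Cardinalities become sums of indicators, so that the double count is an exchange
    of sums.\<close>
  have sum_of_bool: "card {x \<in> A. P x} = (\<Sum>x \<in> A. of_bool (P x))"
    if "finite A" for A :: "'c set" and P
    using that by (simp add: of_bool_def sum.If_cases Int_def)
  have "(THE l. \<exists>u v. e = {u, v} \<and> l = graph_dist G u v) = card {c \<in> verts G - {\<rho>}. ?sep e c}"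
    if "e \<in> ?E" for e
  proof -
    from that obtain u v where e: "e = {u, v}" "u \<in> verts G" "v \<in> verts G" by blast
    have "?sep {u, v} c \<longleftrightarrow> (u \<in> descendants c) \<noteq> (v \<in> descendants c)" for c
      by (auto simp: doubleton_eq_iff)
    then show ?thesis
      using e by (simp add: the_graph_dist graph_dist_eq_card_separators separators_def)
  qed
  then have "wiener_index G = (\<Sum>e \<in> ?E. card {c \<in> verts G - {\<rho>}. ?sep e c})"
    unfolding wiener_index_def by (rule sum.cong[OF refl])
  also have "\<dots> = (\<Sum>e \<in> ?E. \<Sum>c \<in> verts G - {\<rho>}. of_bool (?sep e c))"
    by (intro sum.cong refl sum_of_bool) simp
  also have "\<dots> = (\<Sum>c \<in> verts G - {\<rho>}. \<Sum>e \<in> ?E. of_bool (?sep e c))"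
    by (rule sum.swap)
  also have "\<dots> = (\<Sum>c \<in> verts G - {\<rho>}. card {e \<in> ?E. ?sep e c})"
    by (intro sum.cong refl sum_of_bool[symmetric] finE)
  also have "\<dots> =
      (\<Sum>c \<in> verts G - {\<rho>}. card (descendants c) * (card (verts G) - card (descendants c)))"
  proof (rule sum.cong[OF refl])
    fix c assume "c \<in> verts G - {\<rho>}"
    then have sub: "descendants c \<subseteq> verts G" and fin: "finite (descendants c)"
      by (simp_all add: descendants_subset finite_descendants)
    let ?D = "descendants c \<times> (verts G - descendants c)"
    \<comment> \<open>A separated pair has exactly one end below \<open>c\<close>, so ordering it
      that way is a bijection onto \<open>?D\<close>.\<close>
    have "{e \<in> ?E. ?sep e c} = (\<lambda>(x, y). {x, y}) ` ?D"
    proof (intro equalityI subsetI)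
      fix e assume "e \<in> {e \<in> ?E. ?sep e c}"
      then obtain x y u v where "e = {x, y}" "x \<in> descendants c" "y \<notin> descendants c"
        "e = {u, v}" "u \<in> verts G" "v \<in> verts G" by blast
      then show "e \<in> (\<lambda>(x, y). {x, y}) ` ?D"
        by (intro image_eqI[of _ _ "(x, y)"]) (auto simp: doubleton_eq_iff)
    next
      fix e assume "e \<in> (\<lambda>(x, y). {x, y}) ` ?D"
      then obtain x y where "e = {x, y}" "x \<in> descendants c" "y \<in> verts G" "y \<notin> descendants c"
        by auto
      moreover from this have "x \<in> verts G" "x \<noteq> y" using sub by auto
      ultimately show "e \<in> {e \<in> ?E. ?sep e c}" by blast
    qed
    moreover have "inj_on (\<lambda>(x, y). {x, y}) ?D"
      by (auto simp: inj_on_def doubleton_eq_iff)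
    ultimately have "card {e \<in> ?E. ?sep e c} = card ?D" by (simp add: card_image)
    then show "card {e \<in> ?E. ?sep e c} =
        card (descendants c) * (card (verts G) - card (descendants c))"
      using sub fin by (simp add: card_cartesian_product card_Diff_subset)
  qed
  finally show ?thesis .
qed

section \<open>Counting children and levels\<close>

lemma card_children_root: "card (child_rel `` {\<rho>}) = out_degree G \<rho>"
proof -
  have "child_rel `` {\<rho>} = {w. \<rho> \<rightarrow>\<^bsub>G\<^esub> w}"
    using adj_cases child_relD(4) by (auto simp: child_rel_def)
  then show ?thesis by (simp add: out_degree_eq_card_neighbours)
qed

text \<open>Apart from its one parent, every neighbour is a child.\<close>

lemma out_degree_eq_Suc_card_children:
  assumes "v \<in> verts G" "v \<noteq> \<rho>"
  shows "out_degree G v = Suc (card (child_rel `` {v}))"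
proof -
  obtain u where u: "(u, v) \<in> child_rel" using ex_parent[OF assms] by blast
  have "{w. v \<rightarrow>\<^bsub>G\<^esub> w} = insert u (child_rel `` {v})"
    using u adj_cases[of v] parent_unique[OF u] graph_symmetric by (auto simp: child_rel_def)
  moreover have "u \<notin> child_rel `` {v}"
    using child_relD(3)[OF u] by (auto dest: child_relD(3))
  ultimately show ?thesis
    by (simp add: out_degree_eq_card_neighbours finite_children)
qed

text \<open>The sets of children of the vertices at depth \<open>i\<close> partition the next
  level.\<close>

lemma card_next_depth:
  "card {v \<in> verts G. depth v = Suc i} =
    (\<Sum>v \<in> {v \<in> verts G. depth v = i}. card (child_rel `` {v}))"
proof -
  have "v \<in> (\<Union>u \<in> {u \<in> verts G. depth u = i}. child_rel `` {u})"
    if v: "v \<in> verts G" "depth v = Suc i" for v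
  proof -
    have "v \<noteq> \<rho>" using v depth_root by auto
    then obtain u where "(u, v) \<in> child_rel" using ex_parent v(1) by blast
    then show ?thesis using v child_relD[of u v] by auto
  qed
  then have "{v \<in> verts G. depth v = Suc i} =
      (\<Union>u \<in> {u \<in> verts G. depth u = i}. child_rel `` {u})"
    by (auto dest: child_relD)
  moreover have "card \<dots> = (\<Sum>v \<in> {v \<in> verts G. depth v = i}. card (child_rel `` {v}))"
    by (rule card_UN_disjoint) (auto simp: finite_children dest: parent_unique)
  ultimately show ?thesis by simp
qed

end

section \<open>The formula for generalized Bethe trees\<close>

theorem theorem2p3:
  fixes G :: "('a, 'b) pre_digraph" and \<rho> :: 'a
    and k n :: nat and d N m :: "nat \<Rightarrow> nat"
  assumes "k \<ge> 1"
    and "generalized_Bethe_tree G \<rho>"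
    and "num_levels G \<rho> = k + 1"
    and "card (verts G) = n"
    and "out_degree G \<rho> = d 1"
    and "\<And>i v. \<lbrakk>1 < i; i \<le> k; v \<in> verts G; level G \<rho> v = i\<rbrakk> \<Longrightarrow> out_degree G v = d i + 1"
    and "\<And>i. \<lbrakk>1 \<le> i; i \<le> k\<rbrakk> \<Longrightarrow> N (i + 1) = (\<Prod>j = 1..i. d j)"
    and "\<And>i. \<lbrakk>1 \<le> i; i \<le> k\<rbrakk> \<Longrightarrow> m i = 1 + (\<Sum>j = i + 1..k. \<Prod>r = i + 1..j. d r)"
  shows "int (wiener_index G) = (\<Sum>i = 1..k. int (N (i + 1)) * int (m i) * (int n - int (m i)))"
proof -
  have G: "undirected_tree G" "\<rho> \<in> verts G"
    using assms(2) by (simp_all add: generalized_Bethe_tree_def)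
  interpret graph G using G(1) by (simp add: undirected_tree_def)
  interpret rooted_tree G \<rho> using G by unfold_locales
  \<comment> \<open>indexed by depth, so that \<open>?L i\<close> is the paper's level \<open>i + 1\<close>\<close>
  let ?L = "\<lambda>i. {v \<in> verts G. depth v = i}"
  have depth_le: "depth v \<le> k" if "v \<in> verts G" for v
  proof -
    have "level G \<rho> v \<le> num_levels G \<rho>"
      unfolding num_levels_def using that by (intro Max_ge) auto
    then show ?thesis using assms(3) by (simp add: level_def)
  qed
  have L0: "?L 0 = {\<rho>}" using depth_eq_0 depth_root root by auto
  \<comment> \<open>Depth \<open>i\<close> is level \<open>Suc i\<close>, hence the index of
    \<open>d\<close>. The root is treated apart: it has no parent, so its degree is already its
    number of children.\<close>
  have card_children: "card (child_rel `` {v}) = d (Suc i)"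
    if "v \<in> ?L i" "i < k" for v i
  proof (cases "i = 0")
    case True
    then have "v = \<rho>" using that depth_eq_0 by auto
    then show ?thesis using True card_children_root assms(5) by simp
  next
    case False
    then have "v \<noteq> \<rho>" using that depth_root by auto
    moreover have "out_degree G v = d (Suc i) + 1"
      using that False by (intro assms(6)) (auto simp: level_def)
    ultimately show ?thesis using that out_degree_eq_Suc_card_children by simp
  qed
  have card_L: "card (?L i) = (\<Prod>j = 1..i. d j)" if "i \<le> k" for i
    using that
  proof (induction i)
    case 0
    then show ?case by (subst L0) simp
  next
    case (Suc i)
    then have "card (?L (Suc i)) = (\<Sum>v \<in> ?L i. d (Suc i))"
      by (subst card_next_depth) (intro sum.cong refl card_children, auto)
    then show ?case using Suc by simp
  qed
  \<comment> \<open>Downward induction from \<open>i = k\<close>, because a subtree size is computed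
    from the subtrees one level deeper.\<close>
  have card_desc: "card (descendants v) = m i" if "v \<in> ?L i" "1 \<le> i" "i \<le> k" for v i
    using that(3,1,2)
  proof (induction i arbitrary: v rule: inc_induct)
    case base
    \<comment> \<open>A child would have depth \<open>k + 1\<close>, beyond the maximum. The sum in
      \<open>m k\<close> is empty as well, so both sides are 1.\<close>
    have "child_rel `` {v} = {}"
    proof (rule equals0I)
      fix c assume "c \<in> child_rel `` {v}"
      then show False using base depth_le[of c] child_relD[of v c] by auto
    qed
    then show ?case using base card_descendants[of v] assms(8)[of k] by simp
  next
    case (step i)
    have "card (descendants c) = m (Suc i)" if "c \<in> child_rel `` {v}" for c
      using that step.prems child_relD[of v c] by (intro step.IH) auto
    then have "card (descendants v) = 1 + (\<Sum>c \<in> child_rel `` {v}. m (Suc i))"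
      using step.prems by (simp add: card_descendants del: sum_constant)
    also have "\<dots> = 1 + d (Suc i) * m (Suc i)"
      using card_children[of v i] step by simp
    also have "m (Suc i) = 1 + (\<Sum>j = Suc (Suc i)..k. \<Prod>r = Suc (Suc i)..j. d r)"
      using assms(8)[of "Suc i"] step by simp
    \<comment> \<open>The factor \<open>d (Suc i)\<close> extends each product downwards to
      \<open>r = Suc i\<close>; the isolated \<open>d (Suc i)\<close> then becomes the missing
      summand \<open>j = Suc i\<close>.\<close>
    also have "1 + d (Suc i) * \<dots> =
        1 + (d (Suc i) + (\<Sum>j = Suc (Suc i)..k. \<Prod>r = Suc i..j. d r))"
      by (simp add: sum_distrib_left prod.atLeast_Suc_atMost[of "Suc i"])
    also have "\<dots> = 1 + (\<Sum>j = Suc i..k. \<Prod>r = Suc i..j. d r)"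
      using step by (subst (2) sum.atLeast_Suc_atMost) auto
    also have "\<dots> = m i" using assms(8)[of i] step by simp
    finally show ?case .
  qed
  have "verts G - {\<rho>} = (\<Union>i \<in> {1..k}. ?L i)"
  proof (intro equalityI subsetI)
    fix v assume v: "v \<in> verts G - {\<rho>}"
    then have "depth v \<noteq> 0" using depth_eq_0 by blast
    then show "v \<in> (\<Union>i \<in> {1..k}. ?L i)" using v depth_le[of v] by auto
  qed (auto simp: depth_root)
  then have "wiener_index G = (\<Sum>c \<in> (\<Union>i \<in> {1..k}. ?L i).
      card (descendants c) * (n - card (descendants c)))"
    using wiener_index_eq_sum_descendants assms(4) by simp
  also have "\<dots> = (\<Sum>i = 1..k. \<Sum>c \<in> ?L i. card (descendants c) * (n - card (descendants c)))"
    by (rule sum.UNION_disjoint) auto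
  also have "\<dots> = (\<Sum>i = 1..k. N (i + 1) * (m i * (n - m i)))"
    using card_desc card_L assms(7) by (intro sum.cong) auto
  also have "int \<dots> = (\<Sum>i = 1..k. int (N (i + 1)) * int (m i) * (int n - int (m i)))"
    unfolding of_nat_sum
  proof (rule sum.cong[OF refl])
    fix i assume i: "i \<in> {1..k}"
    show "int (N (i + 1) * (m i * (n - m i))) = int (N (i + 1)) * int (m i) * (int n - int (m i))"
    \<comment> \<open>The truncated \<open>n - m i\<close> equals the integer difference once
      \<open>m i \<le> n\<close>. A vertex at depth \<open>i\<close> witnesses this, its subtree
      having \<open>m i\<close> vertices; without such a vertex the factor \<open>N (i + 1)\<close>
      is 0.\<close>
    proof (cases "?L i = {}")
      case True
      have "N (i + 1) = card (?L i)" using card_L[of i] assms(7)[of i] i by simp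
      then have "N (i + 1) = 0" using True by (simp only: card.empty)
      then show ?thesis by simp
    next
      case False
      then obtain v where v: "v \<in> ?L i" by blast
      then have "m i = card (descendants v)" using card_desc[of v i] i by simp
      also have "\<dots> \<le> n"
        using v descendants_subset[of v] card_mono[OF finite_verts] assms(4) by auto
      finally show ?thesis by simp
    qed
  qed
  finally show ?thesis .
qed

end
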